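(* Every weighted tournament whose weights all have the same parity is inducible by a preference profile that is $2$-dimensional Euclidean under the norm $\ell_2$. Every weighted bipartite tournament whose weights are all even is inducible by a preference profile that is $2$-dimensional Euclidean under the norm $\ell_1$, and also by a preference profile that is $2$-dimensional Euclidean under the norm $\ell_\infty$.
   Context: A weighted tournament on a finite node set $N=\{u_1,\dots,u_n\}$ assigns to each pair $\{u_i,u_j\}$ of distinct nodes either an arc in one direction, say $(u_i,u_j)$, with a positive integer weight $w(u_i,u_j)>0$, or no arc, in which case $w(u_i,u_j)=w(u_j,u_i)=0$; by convention $w(u_j,u_i)=-w(u_i,u_j)$. "All weights have the same parity" refers to all values $w(u_i,u_j)$ over all pairs (including the zero ones). A weighted tournament is bipartite if its underlying digraph is bipartite. A preference profile consists of a set $C$ of candidates and a finite set $V$ of voters (identical copies allowed), each voter $v$ having a strict total order $>_v$ on $C$. The weighted tournament is inducible by a profile if there is a profile with candidate set $C=\{c_1,\dots,c_n\}$ such that for every pair, $w(u_i,u_j)=|\{v\in V: c_i>_v c_j\}|-|\{v\in V: c_j>_v c_i\}|$. For $p\in\{1,2,\infty\}$ and points of $\mathbb{R}^2$, $d_1(x,y)=|x_1-y_1|+|x_2-y_2|$, $d_2(x,y)=\sqrt{(x_1-y_1)^2+(x_2-y_2)^2}$, $d_\infty(x,y)=\max(|x_1-y_1|,|x_2-y_2|)$. A profile is $2$-dimensional Euclidean under $\ell_p$ if there is a mapping $h: C\cup V\to\mathbb{R}^2$ such that for every voter $v$ and distinct candidates $c_i,c_j$: $c_i>_v c_j$ iff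 $d_p(h(v),h(c_i))<d_p(h(v),h(c_j))$. *)

theory Defs
  imports "HOL-Analysis.Analysis"
begin

text \<open>
  Node set \<open>N\<close>, arc set \<open>A\<close>, weight function \<open>w\<close>. Values of \<open>w\<close> on the diagonal or
  outside \<open>N\<close> carry no meaning and are left unconstrained.
\<close>

locale weighted_tournament =
  fixes N :: "'a set" and A :: "('a \<times> 'a) set" and w :: "'a \<Rightarrow> 'a \<Rightarrow> int"
  assumes finite_nodes: "finite N"
    and arcs_subset: "A \<subseteq> N \<times> N"
    and no_loops: "(u, u) \<notin> A"
    and one_direction: "(u, v) \<in> A \<Longrightarrow> (v, u) \<notin> A"
    and weight_arc: "(u, v) \<in> A \<Longrightarrow> w u v > 0"
    and weight_no_arc: "\<lbrakk>u \<in> N; v \<in> N; u \<noteq> v; (u, v) \<notin> A; (v, u) \<notin> A\<rbrakk> \<Longrightarrow> w u v = 0"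
    and weight_skew: "\<lbrakk>u \<in> N; v \<in> N; u \<noteq> v\<rbrakk> \<Longrightarrow> w v u = - w u v"

definition same_parity :: "'a set \<Rightarrow> ('a \<Rightarrow> 'a \<Rightarrow> int) \<Rightarrow> bool" where
  "same_parity N w \<longleftrightarrow>
     (\<forall>u\<in>N. \<forall>v\<in>N. \<forall>x\<in>N. \<forall>y\<in>N. u \<noteq> v \<longrightarrow> x \<noteq> y \<longrightarrow> (even (w u v) \<longleftrightarrow> even (w x y)))"

definition all_even :: "'a set \<Rightarrow> ('a \<Rightarrow> 'a \<Rightarrow> int) \<Rightarrow> bool" where
  "all_even N w \<longleftrightarrow> (\<forall>u\<in>N. \<forall>v\<in>N. u \<noteq> v \<longrightarrow> even (w u v))"

definition bipartite_digraph :: "'a set \<Rightarrow> ('a \<times> 'a) set \<Rightarrow> bool" where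
  "bipartite_digraph N A \<longleftrightarrow>
     (\<exists>X Y. N = X \<union> Y \<and> X \<inter> Y = {} \<and> A \<subseteq> X \<times> Y \<union> Y \<times> X)"

text \<open>
  \<open>(a, b) \<in> pref v\<close> means that voter \<open>v\<close> strictly prefers \<open>a\<close> to \<open>b\<close>. Distinct voters
  may have the same preference order.
\<close>

definition preference_profile :: "'c set \<Rightarrow> 'v set \<Rightarrow> ('v \<Rightarrow> 'c rel) \<Rightarrow> bool" where
  "preference_profile C V pref \<longleftrightarrow>
     finite V \<and> (\<forall>v\<in>V. pref v \<subseteq> C \<times> C \<and> strict_linear_order_on C (pref v))"

text \<open>The candidate \<open>c\<^sub>i\<close> corresponding to the node \<open>u\<^sub>i\<close> is taken to be \<open>u\<^sub>i\<close> itself.\<close>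

definition induces :: "'v set \<Rightarrow> ('v \<Rightarrow> 'a rel) \<Rightarrow> 'a set \<Rightarrow> ('a \<Rightarrow> 'a \<Rightarrow> int) \<Rightarrow> bool" where
  "induces V pref N w \<longleftrightarrow>
     (\<forall>a\<in>N. \<forall>b\<in>N. a \<noteq> b \<longrightarrow>
        w a b = int (card {v \<in> V. (a, b) \<in> pref v}) - int (card {v \<in> V. (b, a) \<in> pref v}))"

definition dist_l1 :: "real ^ 2 \<Rightarrow> real ^ 2 \<Rightarrow> real" where
  "dist_l1 x y = \<bar>x $ 1 - y $ 1\<bar> + \<bar>x $ 2 - y $ 2\<bar>"

definition dist_l2 :: "real ^ 2 \<Rightarrow> real ^ 2 \<Rightarrow> real" where
  "dist_l2 x y = sqrt ((x $ 1 - y $ 1)\<^sup>2 + (x $ 2 - y $ 2)\<^sup>2)"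

definition dist_linf :: "real ^ 2 \<Rightarrow> real ^ 2 \<Rightarrow> real" where
  "dist_linf x y = max \<bar>x $ 1 - y $ 1\<bar> \<bar>x $ 2 - y $ 2\<bar>"

lemma dist_l2_eq_dist: "dist_l2 x y = dist x y"
  by (simp add: dist_l2_def dist_vec_def L2_set_def sum_2 dist_real_def)

text \<open>
  The embedding of the disjoint union of candidates and voters is given by its two
  components \<open>hC\<close> and \<open>hV\<close>.
\<close>

definition euclidean_2d ::
  "(real ^ 2 \<Rightarrow> real ^ 2 \<Rightarrow> real) \<Rightarrow> 'c set \<Rightarrow> 'v set \<Rightarrow> ('v \<Rightarrow> 'c rel) \<Rightarrow> bool" where
  "euclidean_2d d C V pref \<longleftrightarrow>
     (\<exists>(hC :: 'c \<Rightarrow> real ^ 2) (hV :: 'v \<Rightarrow> real ^ 2).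
        \<forall>v\<in>V. \<forall>a\<in>C. \<forall>b\<in>C. a \<noteq> b \<longrightarrow>
          ((a, b) \<in> pref v \<longleftrightarrow> d (hV v) (hC a) < d (hV v) (hC b)))"

text \<open>
  Voters are drawn from \<open>nat\<close>; this is no restriction, since electorates are finite and
  all notions above are invariant under renaming voters.
\<close>

definition inducible_by_euclidean_2d ::
  "(real ^ 2 \<Rightarrow> real ^ 2 \<Rightarrow> real) \<Rightarrow> 'a set \<Rightarrow> ('a \<Rightarrow> 'a \<Rightarrow> int) \<Rightarrow> bool" where
  "inducible_by_euclidean_2d d N w \<longleftrightarrow>
     (\<exists>(V :: nat set) pref. preference_profile N V pref \<and> induces V pref N w
        \<and> euclidean_2d d N V pref)"

end

theory Submission
  imports Defs
begin

text \<open>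
  As in McGarvey's construction, it suffices to find, for one fixed placement of the candidates
  and every pair \<open>(a, b)\<close> that has to gain weight, two voter positions that both prefer \<open>a\<close> to \<open>b\<close>
  and rank every other pair oppositely; copies of these pairs of voters then add up to any even
  weights. The coordinates of the candidates come from an injective map \<open>r\<close> into the positive
  integers whose pairwise sums are distinct.

  For \<open>\<ell>\<^sub>2\<close>, the candidates lie on the parabola \<open>(r, r\<^sup>2)\<close>, where no two chords are parallel. Two very
  distant voters in the two directions orthogonal to the chord \<open>a b\<close> have opposite rankings up to
  the tie between \<open>a\<close> and \<open>b\<close>, which a small shift breaks in favour of \<open>a\<close>. For odd weights, one
  voter at the origin changes all parities.

  For \<open>\<ell>\<^sub>1\<close> with parts \<open>X\<close> and \<open>Y\<close>, the candidates lie on two parallel lines, at \<open>(r, 0)\<close> and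
  \<open>(r, K)\<close>. Voters to the far right and far left order each line in opposite ways, and their
  heights shift the two orders against each other so that only \<open>a \<in> X\<close> and \<open>b \<in> Y\<close> are nearly
  tied. The plane under \<open>\<ell>\<^sub>1\<close> is isometric to the plane under \<open>\<ell>\<^sub>\<infinity>\<close>.
\<close>

section \<open>Electorates over a fixed candidate placement\<close>

definition margin :: "('p \<Rightarrow> 'q \<Rightarrow> real) \<Rightarrow> ('a \<Rightarrow> 'q) \<Rightarrow> 'p \<Rightarrow> 'a \<Rightarrow> 'a \<Rightarrow> int" where
  "margin d h p a b = of_bool (d p (h a) < d p (h b)) - of_bool (d p (h b) < d p (h a))"

text \<open>A list of voter positions keeps repeated voters apart, and injectivity of the distances
  rules out ties. The placement \<open>h\<close> is a parameter, so electorates for the same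
  candidates can be merged.\<close>

definition realizes ::
  "('p \<Rightarrow> 'q \<Rightarrow> real) \<Rightarrow> ('a \<Rightarrow> 'q) \<Rightarrow> 'a set \<Rightarrow> ('a \<Rightarrow> 'a \<Rightarrow> int) \<Rightarrow> 'p list \<Rightarrow> bool" where
  "realizes d h N w ps \<longleftrightarrow>
     (\<forall>p\<in>set ps. inj_on (\<lambda>c. d p (h c)) N)
     \<and> (\<forall>a\<in>N. \<forall>b\<in>N. a \<noteq> b \<longrightarrow> w a b = (\<Sum>p\<leftarrow>ps. margin d h p a b))"

definition realizable ::
  "('p \<Rightarrow> 'q \<Rightarrow> real) \<Rightarrow> ('a \<Rightarrow> 'q) \<Rightarrow> 'a set \<Rightarrow> ('a \<Rightarrow> 'a \<Rightarrow> int) \<Rightarrow> bool" where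
  "realizable d h N w \<longleftrightarrow> (\<exists>ps. realizes d h N w ps)"

lemma realizesI:
  assumes "\<And>p. p \<in> set ps \<Longrightarrow> inj_on (\<lambda>c. d p (h c)) N"
    and "\<And>a b. a \<in> N \<Longrightarrow> b \<in> N \<Longrightarrow> a \<noteq> b \<Longrightarrow> w a b = (\<Sum>p\<leftarrow>ps. margin d h p a b)"
  shows "realizes d h N w ps"
  unfolding realizes_def by (intro conjI ballI impI assms)

lemma realizes_inj_on:
  "realizes d h N w ps \<Longrightarrow> p \<in> set ps \<Longrightarrow> inj_on (\<lambda>c. d p (h c)) N"
  by (simp add: realizes_def)

lemma realizes_eq:
  assumes "realizes d h N w ps" "a \<in> N" "b \<in> N" "a \<noteq> b"
  shows "w a b = (\<Sum>p\<leftarrow>ps. margin d h p a b)"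
  using assms(1)[unfolded realizes_def, THEN conjunct2] assms(2-4) by simp

lemma realizableI: "realizes d h N w ps \<Longrightarrow> realizable d h N w"
  unfolding realizable_def by (rule exI)

lemma realizableE:
  assumes "realizable d h N w"
  obtains ps where "realizes d h N w ps"
  using assms unfolding realizable_def by (rule exE)

lemma realizable_zero: "realizable d h N (\<lambda>a b. 0)"
  by (rule realizableI[of _ _ _ _ "[]"], rule realizesI) simp_all

text \<open>Concatenating two electorates adds their margins.\<close>

lemma realizable_add:
  assumes "realizable d h N w" "realizable d h N w'"
  shows "realizable d h N (\<lambda>a b. w a b + w' a b)"
proof -
  obtain ps where ps: "realizes d h N w ps"
    using assms(1) by (rule realizableE)
  obtain qs where qs: "realizes d h N w' qs"
    using assms(2) by (rule realizableE)
  have "realizes d h N (\<lambda>a b. w a b + w' a b) (ps @ qs)"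
  proof (rule realizesI)
    show "inj_on (\<lambda>c. d p (h c)) N" if "p \<in> set (ps @ qs)" for p
      using that realizes_inj_on[OF ps] realizes_inj_on[OF qs] by auto
  qed (simp add: realizes_eq[OF ps] realizes_eq[OF qs])
  then show ?thesis by (rule realizableI)
qed

lemma realizable_cong:
  assumes "realizable d h N w"
    and "\<And>a b. a \<in> N \<Longrightarrow> b \<in> N \<Longrightarrow> a \<noteq> b \<Longrightarrow> w' a b = w a b"
  shows "realizable d h N w'"
proof -
  obtain ps where ps: "realizes d h N w ps"
    using assms(1) by (rule realizableE)
  have "realizes d h N w' ps"
    by (rule realizesI) (simp_all add: assms(2) realizes_inj_on[OF ps] realizes_eq[OF ps])
  then show ?thesis by (rule realizableI)
qed

lemma realizable_nat_mult:
  "realizable d h N w \<Longrightarrow> realizable d h N (\<lambda>a b. int k * w a b)"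
proof (induction k)
  case 0
  then show ?case by (simp add: realizable_zero)
next
  case (Suc k)
  show ?case
    by (intro realizable_cong[OF realizable_add[OF Suc.prems Suc.IH[OF Suc.prems]]])
      (simp add: distrib_right)
qed

lemma realizable_sum:
  assumes "finite I" "\<And>i. i \<in> I \<Longrightarrow> realizable d h N (f i)"
  shows "realizable d h N (\<lambda>a b. \<Sum>i\<in>I. f i a b)"
  using assms
proof (induction I rule: finite_induct)
  case empty
  then show ?case by (simp add: realizable_zero)
next
  case (insert i I)
  have "realizable d h N (\<lambda>a b. f i a b + (\<Sum>i\<in>I. f i a b))"
    by (rule realizable_add) (use insert in auto)
  with insert.hyps show ?case by simp
qed

lemma realizable_single:
  assumes "inj_on (\<lambda>c. d p (h c)) N"
  shows "realizable d h N (margin d h p)"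
  by (rule realizableI[of _ _ _ _ "[p]"], rule realizesI) (use assms in simp_all)

text \<open>The joint contribution of one McGarvey pair of voters.\<close>

definition pair_weight :: "'a \<Rightarrow> 'a \<Rightarrow> 'a \<Rightarrow> 'a \<Rightarrow> int" where
  "pair_weight a b x y = (if (x, y) = (a, b) then 2 else if (x, y) = (b, a) then -2 else 0)"

lemma realizable_pair_weight:
  assumes "a \<in> N" "b \<in> N"
    and "inj_on (\<lambda>c. d p (h c)) N" "inj_on (\<lambda>c. d q (h c)) N"
    and "d p (h a) < d p (h b)" "d q (h a) < d q (h b)"
    and "\<And>x y. \<lbrakk>x \<in> N; y \<in> N; x \<noteq> y; {x, y} \<noteq> {a, b}\<rbrakk> \<Longrightarrow>
           d p (h x) < d p (h y) \<longleftrightarrow> d q (h y) < d q (h x)"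
  shows "realizable d h N (pair_weight a b)"
proof (rule realizable_cong[OF realizable_add[OF realizable_single realizable_single]])
  fix x y assume xy: "x \<in> N" "y \<in> N" "x \<noteq> y"
  show "pair_weight a b x y = margin d h p x y + margin d h q x y"
  proof (cases "{x, y} = {a, b}")
    case True
    then show ?thesis
      using assms(5,6) xy(3) by (auto simp: pair_weight_def margin_def doubleton_eq_iff)
  next
    case False
    then have "{y, x} \<noteq> {a, b}" by (simp add: insert_commute)
    then show ?thesis
      using assms(7)[OF xy False] assms(7)[OF xy(2,1)] xy(3) False
      by (auto simp: pair_weight_def margin_def)
  qed
qed (use assms in auto)

lemma realizable_even:
  assumes "finite N"
    and skew: "\<And>a b. a \<in> N \<Longrightarrow> b \<in> N \<Longrightarrow> a \<noteq> b \<Longrightarrow> w b a = - w a b"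
    and ev: "\<And>a b. a \<in> N \<Longrightarrow> b \<in> N \<Longrightarrow> a \<noteq> b \<Longrightarrow> even (w a b)"
    and pair: "\<And>a b. a \<in> N \<Longrightarrow> b \<in> N \<Longrightarrow> a \<noteq> b \<Longrightarrow> w a b > 0
                 \<Longrightarrow> realizable d h N (pair_weight a b)"
  shows "realizable d h N w"
proof -
  \<comment> \<open>Each pair of nonzero weight enters in its positive orientation only, so the
    number of copies, half the weight, is nonnegative.\<close>
  define P where "P = {(a, b). a \<in> N \<and> b \<in> N \<and> a \<noteq> b \<and> w a b > 0}"
  have fin: "finite P"
    by (rule finite_subset[of _ "N \<times> N"]) (use assms(1) in \<open>auto simp: P_def\<close>)
  define f where
    "f = (\<lambda>e x y. int (nat (w (fst e) (snd e) div 2)) * pair_weight (fst e) (snd e) x y)"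
  have "realizable d h N (f e)" if "e \<in> P" for e
    unfolding f_def
    by (rule realizable_nat_mult) (use pair that in \<open>auto simp: P_def\<close>)
  then have real: "realizable d h N (\<lambda>x y. \<Sum>e\<in>P. f e x y)"
    using realizable_sum[OF fin, of d h N f] by blast
  show ?thesis
  proof (rule realizable_cong[OF real])
    fix x y assume xy: "x \<in> N" "y \<in> N" "x \<noteq> y"
    \<comment> \<open>For \<open>e = (y, x)\<close> two signs cancel: \<open>pair_weight\<close> is
      -2 and \<open>w y x = - w x y\<close>, so the contribution is again
      \<open>w x y\<close>.\<close>
    have f: "f e x y = (if e = (x, y) then w x y else 0) + (if e = (y, x) then w x y else 0)"
      if "e \<in> P" for e
      using that xy ev[OF xy] ev[OF xy(2,1)] skew[OF xy]
      by (auto simp: f_def pair_weight_def P_def)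
    have "(\<Sum>e\<in>P. f e x y) = (if (x, y) \<in> P then w x y else 0) + (if (y, x) \<in> P then w x y else 0)"
      using fin by (simp add: f sum.distrib sum.delta)
    also have "\<dots> = w x y"
      using xy skew[OF xy] by (auto simp: P_def)
    finally show "w x y = (\<Sum>e\<in>P. f e x y)" by simp
  qed
qed

lemma sum_list_of_bool: "(\<Sum>p\<leftarrow>ps. of_bool (P p)) = int (card {i. i < length ps \<and> P (ps ! i)})"
proof -
  have "(\<Sum>p\<leftarrow>ps. of_bool (P p)) = int (length (filter P ps))"
    by (induction ps) auto
  then show ?thesis by (simp add: length_filter_conv_card)
qed

text \<open>The indices of the list serve as voters, so coinciding positions still count
  separately.\<close>

lemma inducible_if_realizable:
  assumes "realizable d h N w"
  shows "inducible_by_euclidean_2d d N w"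
proof -
  obtain ps where ps: "realizes d h N w ps"
    using assms by (rule realizableE)
  define V where "V = {..<length ps}"
  define pref where "pref v = {(a, b). a \<in> N \<and> b \<in> N \<and> d (ps ! v) (h a) < d (ps ! v) (h b)}" for v
  have "preference_profile N V pref"
    unfolding preference_profile_def
  proof (intro conjI ballI)
    fix v assume "v \<in> V"
    then have v: "inj_on (\<lambda>c. d (ps ! v) (h c)) N"
      using realizes_inj_on[OF ps] by (simp add: V_def)
    show "strict_linear_order_on N (pref v)"
      unfolding strict_linear_order_on_def
    proof (intro conjI)
      show "trans (pref v)" by (auto simp: pref_def trans_def)
      show "irrefl (pref v)" by (auto simp: pref_def irrefl_def)
      show "total_on N (pref v)"
      proof (rule total_onI)
        fix a b assume ab: "a \<in> N" "b \<in> N" "a \<noteq> b"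
        then have "d (ps ! v) (h a) \<noteq> d (ps ! v) (h b)"
          using inj_onD[OF v, of a b] by blast
        then show "(a, b) \<in> pref v \<or> (b, a) \<in> pref v"
          using ab by (auto simp: pref_def)
      qed
    qed
  qed (auto simp: V_def pref_def)
  moreover have "induces V pref N w"
    unfolding induces_def
  proof (intro ballI impI)
    fix a b assume ab: "a \<in> N" "b \<in> N" "a \<noteq> b"
    have "w a b = (\<Sum>p\<leftarrow>ps. of_bool (d p (h a) < d p (h b))) - (\<Sum>p\<leftarrow>ps. of_bool (d p (h b) < d p (h a)))"
      by (simp add: realizes_eq[OF ps ab] margin_def sum_list_subtractf)
    then show "w a b = int (card {v \<in> V. (a, b) \<in> pref v}) - int (card {v \<in> V. (b, a) \<in> pref v})"
      using ab by (simp add: sum_list_of_bool V_def pref_def)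
  qed
  moreover have "euclidean_2d d N V pref"
    unfolding euclidean_2d_def
    by (rule exI[of _ h], rule exI[of _ "\<lambda>v. ps ! v"]) (auto simp: pref_def)
  ultimately show ?thesis
    unfolding inducible_by_euclidean_2d_def by blast
qed

section \<open>Labels with distinct pairwise sums\<close>

text \<open>Uniqueness of binary expansions with two digits: parity decides whether the smaller
  exponent is 0, and otherwise both sides can be halved.\<close>

lemma power_of_2_add_eq:
  fixes i j k l :: nat
  assumes "i < j" "k < l" "(2::int) ^ i + 2 ^ j = 2 ^ k + 2 ^ l"
  shows "i = k \<and> j = l"
  using assms
proof (induction i arbitrary: j k l)
  case 0
  then have "(2::int) ^ k + 2 ^ l = 1 + 2 ^ j" by simp
  moreover have "even ((2::int) ^ j)" "even ((2::int) ^ l)" using 0 by auto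
  ultimately have "odd ((2::int) ^ k)"
    by (metis even_add odd_one)
  then have "k = 0" by (cases k) auto
  then show ?case using 0 by simp
next
  case (Suc i)
  have "even ((2::int) ^ j)" "even ((2::int) ^ l)" "even ((2::int) ^ Suc i)"
    using Suc.prems by auto
  then have "even ((2::int) ^ k)"
    using Suc.prems(3) by (metis even_add)
  then obtain k' where k: "k = Suc k'" by (cases k) auto
  obtain j' where j: "j = Suc j'" using Suc.prems(1) by (cases j) auto
  obtain l' where l: "l = Suc l'" using Suc.prems(2) k by (cases l) auto
  have "i = k' \<and> j' = l'"
  proof (rule Suc.IH)
    show "i < j'" "k' < l'" using Suc.prems j k l by simp_all
    have "2 * ((2::int) ^ i + 2 ^ j') = 2 * (2 ^ k' + 2 ^ l')"
      using Suc.prems(3) unfolding j k l power_Suc distrib_left .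
    then show "(2::int) ^ i + 2 ^ j' = 2 ^ k' + 2 ^ l'" by simp
  qed
  then show ?case by (simp add: j k l)
qed

text \<open>A weak Sidon set: only sums of two distinct elements are compared. Labels are integers,
  so different sums are at least 1 apart.\<close>

definition sidon :: "'a set \<Rightarrow> ('a \<Rightarrow> int) \<Rightarrow> bool" where
  "sidon N r \<longleftrightarrow> inj_on r N \<and> (\<forall>c\<in>N. r c > 0) \<and>
     (\<forall>a\<in>N. \<forall>b\<in>N. \<forall>x\<in>N. \<forall>y\<in>N.
        a \<noteq> b \<longrightarrow> x \<noteq> y \<longrightarrow> r a + r b = r x + r y \<longrightarrow> {a, b} = {x, y})"

lemma finite_imp_sidon:
  assumes "finite N"
  obtains r where "sidon N r"
proof -
  obtain e :: "'a \<Rightarrow> nat" where e: "inj_on e N"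
    using finite_imp_inj_to_nat_seg[OF assms] by blast
  define r where "r c = (2::int) ^ e c" for c
  have "{a, b} = {x, y}"
    if "a \<in> N" "b \<in> N" "x \<in> N" "y \<in> N" "a \<noteq> b" "x \<noteq> y" "r a + r b = r x + r y" for a b x y
  proof -
    have *: "e a \<noteq> e b" "e x \<noteq> e y"
      using that e by (auto dest: inj_onD)
    have "{e a, e b} = {e x, e y}"
      using * that(7)[unfolded r_def]
        power_of_2_add_eq[of "e a" "e b" "e x" "e y"] power_of_2_add_eq[of "e a" "e b" "e y" "e x"]
        power_of_2_add_eq[of "e b" "e a" "e x" "e y"] power_of_2_add_eq[of "e b" "e a" "e y" "e x"]
      by (cases "e a < e b"; cases "e x < e y") (simp_all add: ac_simps neq_iff insert_commute)
    then have "e ` {a, b} = e ` {x, y}" by simp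
    then show ?thesis
      using inj_on_image_eq_iff[OF e, of "{a, b}" "{x, y}"] that by simp
  qed
  moreover have "inj_on r N"
    using e by (auto simp: r_def inj_on_def)
  moreover have "\<forall>c\<in>N. r c > 0"
    by (simp add: r_def)
  ultimately have "sidon N r"
    unfolding sidon_def by blast
  then show thesis by (rule that)
qed

lemma finite_strict_bound:
  fixes f :: "'b \<Rightarrow> real"
  assumes "finite I"
  obtains M where "\<And>i. i \<in> I \<Longrightarrow> \<bar>f i\<bar> < M"
proof
  fix i assume "i \<in> I"
  then have "\<bar>f i\<bar> \<le> (\<Sum>i\<in>I. \<bar>f i\<bar>)"
    using assms by (intro member_le_sum) auto
  then show "\<bar>f i\<bar> < 1 + (\<Sum>i\<in>I. \<bar>f i\<bar>)" by simp
qed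

section \<open>Candidates on a parabola under the Euclidean norm\<close>

text \<open>The difference of the squared distances has the factor \<open>x - y\<close>. The
  cofactor is symmetric in \<open>x\<close> and \<open>y\<close>, and for
  \<open>x \<noteq> y\<close> it vanishes exactly at ties.\<close>

lemma dist_l2_parabola_less:
  fixes p q x y :: real
  shows "dist_l2 (vector [p, q]) (vector [x, x\<^sup>2]) < dist_l2 (vector [p, q]) (vector [y, y\<^sup>2])
    \<longleftrightarrow> (x - y) * ((x + y) * (1 + x\<^sup>2 + y\<^sup>2 - 2 * q) - 2 * p) < 0"
proof -
  have "(p - x)\<^sup>2 + (q - x\<^sup>2)\<^sup>2 - ((p - y)\<^sup>2 + (q - y\<^sup>2)\<^sup>2)
      = (x - y) * ((x + y) * (1 + x\<^sup>2 + y\<^sup>2 - 2 * q) - 2 * p)"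
    by algebra
  then show ?thesis
    unfolding dist_l2_def real_sqrt_less_iff vector_2 by linarith
qed

lemma inj_on_dist_l2_parabola:
  fixes p q :: real and r :: "'a \<Rightarrow> real"
  assumes "inj_on r N"
    and "\<And>x y. x \<in> N \<Longrightarrow> y \<in> N \<Longrightarrow> x \<noteq> y \<Longrightarrow>
           (r x + r y) * (1 + (r x)\<^sup>2 + (r y)\<^sup>2 - 2 * q) - 2 * p \<noteq> 0"
  shows "inj_on (\<lambda>c. dist_l2 (vector [p, q]) (vector [r c, (r c)\<^sup>2])) N"
proof (rule inj_onI, rule ccontr)
  fix x y assume xy: "x \<in> N" "y \<in> N" "x \<noteq> y"
    and eq: "dist_l2 (vector [p, q]) (vector [r x, (r x)\<^sup>2])
      = dist_l2 (vector [p, q]) (vector [r y, (r y)\<^sup>2])"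
  let ?F = "(r x + r y) * (1 + (r x)\<^sup>2 + (r y)\<^sup>2 - 2 * q) - 2 * p"
  have "r x \<noteq> r y" using xy assms(1) by (auto dest: inj_onD)
  then have "(r x - r y) * ?F \<noteq> 0" using assms(2)[OF xy] by simp
  moreover have "\<not> (r x - r y) * ?F < 0"
    using dist_l2_parabola_less[of p q "r x" "r y"] eq by simp
  moreover have "\<not> (r y - r x) * ?F < 0"
    using dist_l2_parabola_less[of p q "r y" "r x"] eq by (simp add: ac_simps)
  then have "(r x - r y) * ?F \<le> 0"
    by (simp add: algebra_simps)
  ultimately show False by linarith
qed

lemma realizable_pair_weight_l2:
  assumes "finite N" "sidon N r" "a \<in> N" "b \<in> N" "a \<noteq> b"
  shows "realizable dist_l2 (\<lambda>c. vector [of_int (r c), (of_int (r c))\<^sup>2]) N (pair_weight a b)"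
proof -
  define \<rho> :: "'a \<Rightarrow> real" where "\<rho> c = of_int (r c)" for c
  have inj: "inj_on \<rho> N"
    using assms(2) by (auto simp: sidon_def \<rho>_def inj_on_def)
  define m where "m = \<rho> a + \<rho> b"
  \<comment> \<open>chosen so that \<open>g a b = b - a\<close>, hence both voters below prefer \<open>a\<close> to \<open>b\<close>\<close>
  define \<epsilon> where "\<epsilon> = (\<rho> a + \<rho> b) * (1 + (\<rho> a)\<^sup>2 + (\<rho> b)\<^sup>2) + (\<rho> a - \<rho> b)"
  define g where "g x y = (\<rho> x + \<rho> y) * (1 + (\<rho> x)\<^sup>2 + (\<rho> y)\<^sup>2) - \<epsilon>" for x y
  obtain M where "\<And>e. e \<in> N \<times> N \<Longrightarrow> \<bar>case_prod g e\<bar> < M"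
    using finite_strict_bound[of "N \<times> N" "case_prod g"] assms(1) by blast
  then have M: "\<bar>g x y\<bar> < M" if "x \<in> N" "y \<in> N" for x y
    using that by fastforce
  \<comment> \<open>The cofactor at the voter \<open>v T\<close> below. The coefficient of
    \<open>T\<close> compares the slopes \<open>\<rho> x + \<rho> y\<close> and \<open>m\<close> of
    the chords \<open>x y\<close> and \<open>a b\<close>, so it vanishes for the pair
    \<open>a\<close>, \<open>b\<close>.\<close>
  have F: "(\<rho> x + \<rho> y) * (1 + (\<rho> x)\<^sup>2 + (\<rho> y)\<^sup>2 - 2 * (T / 2)) - 2 * ((\<epsilon> - T * m) / 2)
      = g x y - T * (\<rho> x + \<rho> y - m)" for x y T
    by (simp add: g_def field_simps)
  have Fab: "g x y - T * (\<rho> x + \<rho> y - m) = \<rho> b - \<rho> a" if "{x, y} = {a, b}" for x y T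
    using that by (auto simp: doubleton_eq_iff g_def m_def \<epsilon>_def add_ac)
  \<comment> \<open>For any other pair the slopes differ by at least 1, so at \<open>T = M\<close>
    and \<open>T = - M\<close> the term with \<open>T\<close> outweighs \<open>g\<close> and
    determines the sign.\<close>
  have sep: "\<bar>g x y\<bar> < \<bar>M * (\<rho> x + \<rho> y - m)\<bar>"
    if "x \<in> N" "y \<in> N" "x \<noteq> y" "{x, y} \<noteq> {a, b}" for x y
  proof -
    have "r x + r y \<noteq> r a + r b"
      using assms that unfolding sidon_def by blast
    then have "1 \<le> \<bar>r x + r y - (r a + r b)\<bar>" by linarith
    then have "(1::real) \<le> of_int \<bar>r x + r y - (r a + r b)\<bar>" by linarith
    then have "1 \<le> \<bar>\<rho> x + \<rho> y - m\<bar>"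
      by (simp add: \<rho>_def m_def)
    moreover have "0 \<le> M" using M[OF that(1,2)] by linarith
    ultimately have "M \<le> \<bar>M * (\<rho> x + \<rho> y - m)\<bar>"
      by (simp add: abs_mult mult_le_cancel_left1)
    then show ?thesis using M[OF that(1,2)] by linarith
  qed
  have ab: "\<rho> a \<noteq> \<rho> b" using inj assms by (auto dest: inj_onD)
  have nz: "g x y - T * (\<rho> x + \<rho> y - m) \<noteq> 0"
    if "x \<in> N" "y \<in> N" "x \<noteq> y" "T = M \<or> T = - M" for x y T
  proof (cases "{x, y} = {a, b}")
    case True
    then show ?thesis using Fab[OF True, of T] ab by linarith
  next
    case False
    then show ?thesis using sep[OF that(1-3) False] that(4) by auto
  qed
  \<comment> \<open>The parameter \<open>T\<close> moves the voter along \<open>(- m, 1)\<close>,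
    the normal of the chord \<open>a b\<close>; \<open>\<epsilon> / 2\<close> is the shift that
    breaks the tie.\<close>
  define v where "v T = (vector [(\<epsilon> - T * m) / 2, T / 2] :: real ^ 2)" for T
  have less: "dist_l2 (v T) (vector [\<rho> x, (\<rho> x)\<^sup>2]) < dist_l2 (v T) (vector [\<rho> y, (\<rho> y)\<^sup>2])
      \<longleftrightarrow> (\<rho> x - \<rho> y) * (g x y - T * (\<rho> x + \<rho> y - m)) < 0" for x y T
    unfolding v_def dist_l2_parabola_less F ..
  have vinj: "inj_on (\<lambda>c. dist_l2 (v T) (vector [\<rho> c, (\<rho> c)\<^sup>2])) N" if "T = M \<or> T = - M" for T
    unfolding v_def by (rule inj_on_dist_l2_parabola[OF inj]) (unfold F, use nz that in blast)
  have vab: "dist_l2 (v T) (vector [\<rho> a, (\<rho> a)\<^sup>2]) < dist_l2 (v T) (vector [\<rho> b, (\<rho> b)\<^sup>2])" for T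
    using ab unfolding less Fab[OF refl] mult_less_0_iff by linarith
  have "realizable dist_l2 (\<lambda>c. vector [\<rho> c, (\<rho> c)\<^sup>2]) N (pair_weight a b)"
  proof (rule realizable_pair_weight[where p = "v M" and q = "v (- M)"])
    fix x y assume xy: "x \<in> N" "y \<in> N" "x \<noteq> y" "{x, y} \<noteq> {a, b}"
    have gc: "g y x = g x y" by (simp add: g_def ac_simps)
    show "dist_l2 (v M) (vector [\<rho> x, (\<rho> x)\<^sup>2]) < dist_l2 (v M) (vector [\<rho> y, (\<rho> y)\<^sup>2])
      \<longleftrightarrow> dist_l2 (v (- M)) (vector [\<rho> y, (\<rho> y)\<^sup>2]) < dist_l2 (v (- M)) (vector [\<rho> x, (\<rho> x)\<^sup>2])"
      unfolding less gc add.commute[of "\<rho> y"] mult_less_0_iff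
      using sep[OF xy] by auto
  qed (use assms vinj vab in auto)
  then show ?thesis by (simp add: \<rho>_def)
qed

text \<open>Provides the extra voter for odd weights: with positive labels the cofactor is positive
  at the origin.\<close>

lemma inj_on_dist_l2_origin:
  assumes "sidon N r"
  shows "inj_on (\<lambda>c. dist_l2 (vector [0, 0]) (vector [of_int (r c), (of_int (r c))\<^sup>2])) N"
proof (rule inj_on_dist_l2_parabola)
  show "inj_on (\<lambda>c. real_of_int (r c)) N"
    using assms by (auto simp: sidon_def inj_on_def)
  fix x y assume "x \<in> N" "y \<in> N"
  then have "r x > 0" "r y > 0" using assms by (auto simp: sidon_def)
  then have "0 < (real_of_int (r x) + of_int (r y)) * (1 + (of_int (r x))\<^sup>2 + (of_int (r y))\<^sup>2)"
    by (intro mult_pos_pos add_pos_nonneg) auto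
  then show "(real_of_int (r x) + of_int (r y))
      * (1 + (of_int (r x))\<^sup>2 + (of_int (r y))\<^sup>2 - 2 * 0) - 2 * 0 \<noteq> 0"
    by (simp only: mult_zero_right diff_zero)
qed

lemma odd_margin:
  assumes "inj_on (\<lambda>c. d p (h c)) N" "a \<in> N" "b \<in> N" "a \<noteq> b"
  shows "odd (margin d h p a b)"
proof -
  have "d p (h a) \<noteq> d p (h b)" using assms by (auto dest: inj_onD)
  then show ?thesis by (auto simp: margin_def)
qed

lemma inducible_l2:
  assumes "weighted_tournament N A w" "same_parity N w"
  shows "inducible_by_euclidean_2d dist_l2 N w"
proof -
  interpret weighted_tournament N A w by fact
  obtain r where r: "sidon N r" using finite_imp_sidon[OF finite_nodes] .
  let ?h = "\<lambda>c. vector [of_int (r c), (of_int (r c))\<^sup>2] :: real ^ 2"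
  let ?w0 = "margin dist_l2 ?h (vector [0, 0])"
  note inj = inj_on_dist_l2_origin[OF r]
  have even: "realizable dist_l2 ?h N u"
    if "\<And>a b. a \<in> N \<Longrightarrow> b \<in> N \<Longrightarrow> a \<noteq> b \<Longrightarrow> u b a = - u a b"
      "\<And>a b. a \<in> N \<Longrightarrow> b \<in> N \<Longrightarrow> a \<noteq> b \<Longrightarrow> even (u a b)" for u
    using finite_nodes that realizable_pair_weight_l2[OF finite_nodes r]
    by (rule realizable_even)
  have "realizable dist_l2 ?h N w"
  proof (cases "\<forall>a\<in>N. \<forall>b\<in>N. a \<noteq> b \<longrightarrow> even (w a b)")
    case True
    show ?thesis
    proof (rule even)
      fix a b assume ab: "a \<in> N" "b \<in> N" "a \<noteq> b"
      show "w b a = - w a b" using weight_skew[OF ab] .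
      show "even (w a b)" using True ab by blast
    qed
  next
    case False
    then have odd: "odd (w a b)" if "a \<in> N" "b \<in> N" "a \<noteq> b" for a b
      using assms(2) that unfolding same_parity_def by blast
    \<comment> \<open>A voter without ties has an odd margin on every pair, so subtracting it leaves
      even, still skew weights.\<close>
    have "realizable dist_l2 ?h N (\<lambda>a b. w a b - ?w0 a b)"
    proof (rule even)
      fix a b assume ab: "a \<in> N" "b \<in> N" "a \<noteq> b"
      show "w b a - ?w0 b a = - (w a b - ?w0 a b)"
        using weight_skew[OF ab] by (simp add: margin_def)
      show "even (w a b - ?w0 a b)"
        using odd[OF ab] odd_margin[where d = dist_l2, OF inj ab] by simp
    qed
    from realizable_add[OF this realizable_single[where d = dist_l2, OF inj]]
    show ?thesis by simp
  qed
  then show ?thesis by (rule inducible_if_realizable)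
qed

section \<open>Candidates on two parallel lines under the Manhattan norm\<close>

text \<open>For \<open>x \<in> X\<close> and \<open>y \<in> Y\<close>, put
  \<open>t = r y - r x - D\<close>. The distance to \<open>y\<close> minus that to \<open>x\<close>
  is \<open>\<delta> - t\<close> for \<open>p\<close> and \<open>\<delta> + t\<close> for
  \<open>q\<close>. These have opposite signs when \<open>\<bar>t\<bar> \<ge> 1\<close>, and both
  equal \<open>\<delta>\<close> when \<open>t = 0\<close>.\<close>

lemma realizable_pair_weight_l1:
  fixes r :: "'a \<Rightarrow> int" and M :: real
  assumes "sidon N r" "N = X \<union> Y" "X \<inter> Y = {}"
    and M: "\<And>c. c \<in> N \<Longrightarrow> of_int (r c) < M"
    and ab: "(a, b) \<in> X \<times> Y \<union> Y \<times> X"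
  shows "realizable dist_l1
     (\<lambda>c. vector [of_int (r c), if c \<in> X then 0 else M + 1]) N (pair_weight a b)"
proof -
  let ?h = "\<lambda>c. vector [of_int (r c), if c \<in> X then 0 else M + 1] :: real ^ 2"
  \<comment> \<open>The pair is reordered to start in \<open>X\<close>; the sign of
    \<open>\<delta>\<close> remembers which end has to be preferred.\<close>
  obtain a' b' \<delta> where a': "a' \<in> X" and b': "b' \<in> Y"
    and \<delta>: "(a, b, \<delta>) = (a', b', 1/2) \<or> (a, b, \<delta>) = (b', a', - (1/2 :: real))"
    using ab by blast
  define D where "D = real_of_int (r b') - of_int (r a')"
  define p where "p = (vector [M, (M + 1 - D - \<delta>) / 2] :: real ^ 2)"
  define q where "q = (vector [- M, (M + 1 + D - \<delta>) / 2] :: real ^ 2)"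
  have pos: "0 < r c" if "c \<in> N" for c using assms(1) that by (simp add: sidon_def)
  have D: "- M < D" "D < M" and M0: "0 < M"
    using M[of a'] M[of b'] pos[of a'] pos[of b'] a' b' assms(2) by (auto simp: D_def)
  have \<delta>': "- (1/2) \<le> \<delta>" "\<delta> \<le> 1/2" using \<delta> by auto
  \<comment> \<open>The voter lies to the right of all candidates and at a height between the two
    lines, which resolves both absolute values; \<open>q\<close> lies to their left.\<close>
  have p: "dist_l1 p (?h c) = (if c \<in> X then M - of_int (r c) + (M + 1 - D - \<delta>) / 2
      else M - of_int (r c) + (M + 1 + D + \<delta>) / 2)" if "c \<in> N" for c
    using M[OF that] D \<delta>' by (cases "c \<in> X") (simp_all add: dist_l1_def p_def abs_real_def field_simps)
  have q: "dist_l1 q (?h c) = (if c \<in> X then M + of_int (r c) + (M + 1 + D - \<delta>) / 2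
      else M + of_int (r c) + (M + 1 - D + \<delta>) / 2)" if "c \<in> N" for c
    using M0 pos[OF that] D \<delta>' by (cases "c \<in> X") (simp_all add: dist_l1_def q_def abs_real_def field_simps)
  have sep: "r y - r x - (r b' - r a') \<le> -1 \<or> 1 \<le> r y - r x - (r b' - r a')"
    if "x \<in> X" "y \<in> Y" "{x, y} \<noteq> {a, b}" for x y
  proof -
    have ne: "y \<noteq> a'" "b' \<noteq> x" "a' \<noteq> b'" using that a' b' assms(3) by auto
    \<comment> \<open>Equal differences \<open>r y - r x\<close> and \<open>r b' - r a'\<close>
      become equal sums, to which the Sidon property applies.\<close>
    have "r y + r a' \<noteq> r b' + r x"
    proof
      assume "r y + r a' = r b' + r x"
      then have "{y, a'} = {b', x}"
        using assms(1,2) a' b' that ne unfolding sidon_def by blast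
      then show False
        using ne that(3) \<delta> by (auto simp: doubleton_eq_iff)
    qed
    then show ?thesis by linarith
  qed
  have sep': "real_of_int (r y) - of_int (r x) - D \<le> -1 \<or> 1 \<le> real_of_int (r y) - of_int (r x) - D"
    if "x \<in> X" "y \<in> Y" "{x, y} \<noteq> {a, b}" for x y
    using sep[OF that] unfolding D_def by linarith
  have rne: "real_of_int (r x) \<noteq> of_int (r y)" if "x \<in> N" "y \<in> N" "x \<noteq> y" for x y
    using assms(1) that by (auto simp: sidon_def dest: inj_onD)
  have pq: "dist_l1 p (?h x) \<noteq> dist_l1 p (?h y) \<and> dist_l1 q (?h x) \<noteq> dist_l1 q (?h y) \<and>
      (dist_l1 p (?h x) < dist_l1 p (?h y) \<longleftrightarrow> dist_l1 q (?h y) < dist_l1 q (?h x))"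
    if xy: "x \<in> N" "y \<in> N" "x \<noteq> y" "{x, y} \<noteq> {a, b}" for x y
  proof -
    consider "x \<in> X \<longleftrightarrow> y \<in> X" | "x \<in> X" "y \<in> Y" "y \<notin> X" | "x \<in> Y" "x \<notin> X" "y \<in> X"
      using xy assms(2,3) by auto
    then show ?thesis
    proof cases
      case 1
      then show ?thesis using rne[OF xy(1-3)] unfolding p[OF xy(1)] p[OF xy(2)] q[OF xy(1)] q[OF xy(2)]
        by (cases "x \<in> X") auto
    next
      case 2
      then show ?thesis using sep'[OF 2(1,2) xy(4)] \<delta>'
        unfolding p[OF xy(1)] p[OF xy(2)] q[OF xy(1)] q[OF xy(2)] by (auto simp: field_simps)
    next
      case 3
      then have "{y, x} \<noteq> {a, b}" using xy(4) by (simp add: insert_commute)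
      then show ?thesis using sep'[OF 3(3,1)] 3 \<delta>'
        unfolding p[OF xy(1)] p[OF xy(2)] q[OF xy(1)] q[OF xy(2)] by (auto simp: field_simps)
    qed
  qed
  have N: "a \<in> N" "b \<in> N" using ab assms(2) by auto
  have less: "dist_l1 p (?h a) < dist_l1 p (?h b)" "dist_l1 q (?h a) < dist_l1 q (?h b)"
    using \<delta> a' b' assms(3) unfolding p[OF N(1)] p[OF N(2)] q[OF N(1)] q[OF N(2)]
    by (auto simp: D_def field_simps)
  have ne: "dist_l1 p (?h x) \<noteq> dist_l1 p (?h y) \<and> dist_l1 q (?h x) \<noteq> dist_l1 q (?h y)"
    if "x \<in> N" "y \<in> N" "x \<noteq> y" for x y
  proof (cases "{x, y} = {a, b}")
    case True
    then show ?thesis using less by (auto simp: doubleton_eq_iff)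
  next
    case False
    then show ?thesis using pq that by blast
  qed
  show ?thesis
    by (rule realizable_pair_weight[where p = p and q = q])
      (use N less pq ne in \<open>blast intro: inj_onI\<close>)+
qed

text \<open>The placement is kept explicit so that the electorate can be transported to the maximum
  norm.\<close>

lemma realizable_l1:
  assumes "weighted_tournament N A w" "bipartite_digraph N A" "all_even N w"
  obtains h where "realizable dist_l1 h N w"
proof -
  interpret weighted_tournament N A w by fact
  obtain X Y where XY: "N = X \<union> Y" "X \<inter> Y = {}" "A \<subseteq> X \<times> Y \<union> Y \<times> X"
    using assms(2) unfolding bipartite_digraph_def by blast
  obtain r where r: "sidon N r" using finite_imp_sidon[OF finite_nodes] .
  obtain M :: real where "\<And>c. c \<in> N \<Longrightarrow> \<bar>of_int (r c)\<bar> < M"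
    using finite_strict_bound[OF finite_nodes, of "\<lambda>c. of_int (r c)"] by blast
  then have M: "\<And>c. c \<in> N \<Longrightarrow> of_int (r c) < M" by fastforce
  show thesis
  proof (rule that, rule realizable_even[OF finite_nodes])
    fix a b assume ab: "a \<in> N" "b \<in> N" "a \<noteq> b"
    show "w b a = - w a b" using weight_skew[OF ab] .
    show "even (w a b)" using assms(3) ab by (simp add: all_even_def)
    assume "0 < w a b"
    then have "(a, b) \<in> A \<or> (b, a) \<in> A"
      using weight_no_arc[OF ab] by fastforce
    then have "(a, b) \<in> X \<times> Y \<union> Y \<times> X" using XY(3) by blast
    then show "realizable dist_l1
        (\<lambda>c. vector [of_int (r c), if c \<in> X then 0 else M + 1]) N (pair_weight a b)"
      using realizable_pair_weight_l1[OF r XY(1,2) M] by blast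
  qed
qed

section \<open>Transfer to the maximum norm\<close>

definition rotate_scale :: "real ^ 2 \<Rightarrow> real ^ 2" where
  "rotate_scale x = vector [x $ 1 + x $ 2, x $ 1 - x $ 2]"

text \<open>For coordinate differences \<open>s\<close> and \<open>t\<close>, the larger of
  \<open>\<bar>s + t\<bar>\<close> and \<open>\<bar>s - t\<bar>\<close> is
  \<open>\<bar>s\<bar> + \<bar>t\<bar>\<close>.\<close>

lemma dist_linf_rotate_scale: "dist_linf (rotate_scale x) (rotate_scale y) = dist_l1 x y"
  by (auto simp: dist_linf_def dist_l1_def rotate_scale_def abs_real_def max_def)

lemma realizable_isometry:
  assumes "\<And>x y. d' (f x) (g y) = d x y" "realizable d h N w"
  shows "realizable d' (g \<circ> h) N w"
proof -
  obtain ps where ps: "realizes d h N w ps"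
    using assms(2) by (rule realizableE)
  have "realizes d' (g \<circ> h) N w (map f ps)"
    by (rule realizesI)
      (auto simp: assms(1) margin_def comp_def realizes_eq[OF ps] intro: realizes_inj_on[OF ps])
  then show ?thesis by (rule realizableI)
qed

theorem theorem2:
  fixes N :: "'a set" and A :: "('a \<times> 'a) set" and w :: "'a \<Rightarrow> 'a \<Rightarrow> int"
  assumes "weighted_tournament N A w"
  shows "(same_parity N w \<longrightarrow> inducible_by_euclidean_2d dist_l2 N w)
    \<and> (bipartite_digraph N A \<and> all_even N w \<longrightarrow>
         inducible_by_euclidean_2d dist_l1 N w \<and> inducible_by_euclidean_2d dist_linf N w)"
proof (intro conjI impI)
  assume "same_parity N w"
  then show "inducible_by_euclidean_2d dist_l2 N w"
    using inducible_l2 assms by blast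
next
  assume "bipartite_digraph N A \<and> all_even N w"
  then obtain h where h: "realizable dist_l1 h N w"
    using realizable_l1 assms by blast
  then show "inducible_by_euclidean_2d dist_l1 N w"
    by (rule inducible_if_realizable)
  show "inducible_by_euclidean_2d dist_linf N w"
    using realizable_isometry[where d' = dist_linf and f = rotate_scale and g = rotate_scale,
        OF dist_linf_rotate_scale h]
    by (rule inducible_if_realizable)
qed

end
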